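(* Let $(\Omega,F,\eta)$ and $(\Omega,F,\tau)$ be probability spaces, let $f:\Omega\to\Omega^*$ be a measurable mapping from $(\Omega,F)$ into $(\Omega^*,F^* )$, and let $\eta^*$ and $\tau^*$ be the image measures of $\eta$ and $\tau$ under $f$. If $f$ is a bijective mapping, then $$\eta\ll\tau \text{ if and only if } \eta^*\ll\tau^*,\qquad\text{and}\qquad \eta\perp\tau \text{ if and only if } \eta^*\perp\tau^*.$$
   Context: Here $(\Omega^*,F^* )$ is a measurable space, and the image measures on it are defined by $\eta^*(E)=\eta(f^{-1}(E))$ and $\tau^*(E)=\tau(f^{-1}(E))$ for every $E\in F^*$, where $f^{-1}(E)=\{\omega\in\Omega: f(\omega)\in E\}$. The notation $\ll$ means absolute continuity and $\perp$ means mutual singularity of measures.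
   Formalization: The inverse of the bijection f is additionally assumed measurable from (Ω*,F* ) to (Ω,F); for a merely measurable bijection the claim fails, e.g. the identity on two points with F all subsets, F* trivial, and η, τ distinct point masses. *)

theory Defs
  imports "HOL-Probability.Probability"
begin

text \<open>
  Mutual singularity of two measures on the same \<open>\<sigma>\<close>-algebra. For absolute continuity the library
  predicate is used; note its argument order: \<^term>\<open>absolutely_continuous \<tau> \<eta>\<close> means \<open>\<eta> \<ll> \<tau>\<close>.
\<close>

definition mutually_singular :: "'a measure \<Rightarrow> 'a measure \<Rightarrow> bool" where
  "mutually_singular M N \<longleftrightarrow>
     (\<exists>A\<in>sets M. emeasure M A = 0 \<and> emeasure N (space M - A) = 0)"

text \<open>
  Measurability of the inverse mapping is an extra condition, not implied by bijectivity of \<open>f\<close>: for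
  the identity from a two-point space with all subsets measurable to the same space with the trivial
  \<open>\<sigma>\<close>-algebra, two distinct point masses are mutually singular but have the same image. Images of
  measures under \<open>f\<close> therefore reflect absolute continuity and singularity only for bijections in the
  sense of measurable spaces, i.e. with a measurable inverse.
\<close>

end

theory Submission
  imports Defs
begin

text \<open>
  For every measurable map, absolute continuity passes to the image measures and mutual
  singularity passes back from them. A measurable inverse pushes the image measures back to the
  original ones, which gives the two remaining directions.
\<close>

text \<open>A measurable set is null for an image measure exactly when its preimage is null for the
  original measure, so the inclusion of null sets is inherited.\<close>

lemma absolutely_continuous_distr:
  assumes f: "f \<in> measurable M K" and sets: "sets N = sets M"
    and ac: "absolutely_continuous M N"
  shows "absolutely_continuous (distr M K f) (distr N K f)"
proof -
  have "f \<in> measurable N K"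
    using f measurable_cong_sets[OF sets refl] by blast
  then show ?thesis
    using f ac sets_eq_imp_space_eq[OF sets]
    by (auto simp: absolutely_continuous_def null_sets_distr_iff)
qed

text \<open>The preimage of a separating set separates the original measures. The converse needs
  more, since a separating set in \<open>M\<close> need not be a preimage.\<close>

lemma mutually_singular_if_distr:
  assumes f: "f \<in> measurable M K" and sets: "sets N = sets M"
    and sing: "mutually_singular (distr M K f) (distr N K f)"
  shows "mutually_singular M N"
proof -
  have fN: "f \<in> measurable N K"
    using f measurable_cong_sets[OF sets refl] by blast
  have space: "space N = space M"
    by (rule sets_eq_imp_space_eq[OF sets])
  obtain B where B: "B \<in> sets K" "emeasure (distr M K f) B = 0"
      "emeasure (distr N K f) (space K - B) = 0"
    using sing by (auto simp: mutually_singular_def)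
  let ?A = "f -` B \<inter> space M"
  have "?A \<in> sets M" "emeasure M ?A = 0"
    using f B by (auto simp: emeasure_distr)
  \<comment> \<open>Preimages commute with complements because \<open>f\<close> maps
    \<open>space M\<close> into \<open>space K\<close>.\<close>
  moreover have "space M - ?A = f -` (space K - B) \<inter> space N"
    using measurable_space[OF f] space by auto
  then have "emeasure N (space M - ?A) = 0"
    using fN B by (simp add: emeasure_distr)
  ultimately show ?thesis
    by (auto simp: mutually_singular_def)
qed

lemma distr_distr_left_inverse:
  assumes f: "f \<in> measurable M K" and g: "g \<in> measurable K M"
    and inv: "\<And>x. x \<in> space M \<Longrightarrow> g (f x) = x"
    and sets: "sets N = sets M"
  shows "distr (distr N K f) M g = N"
proof -
  have "f \<in> measurable N K"
    using f measurable_cong_sets[OF sets refl] by blast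
  then have "distr (distr N K f) M g = distr N M (g \<circ> f)"
    using g by (simp add: distr_distr)
  \<comment> \<open>\<open>g \<circ> f\<close> is the identity only on the space of
    \<open>N\<close>, but an image measure depends on no other values of the map.\<close>
  also have "\<dots> = distr N M (\<lambda>x. x)"
    using inv sets_eq_imp_space_eq[OF sets] by (intro distr_cong) auto
  also have "\<dots> = N"
    by (rule distr_id2) (simp add: sets)
  finally show ?thesis .
qed

theorem theorem5:
  fixes F \<eta> \<tau> :: "'a measure" and Fs :: "'b measure" and f :: "'a \<Rightarrow> 'b"
  assumes "prob_space \<eta>" and "sets \<eta> = sets F"
    and "prob_space \<tau>" and "sets \<tau> = sets F"
    and "f \<in> measurable F Fs"
    and "bij_betw f (space F) (space Fs)"
    and "the_inv_into (space F) f \<in> measurable Fs F"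
  shows "(absolutely_continuous \<tau> \<eta> \<longleftrightarrow>
            absolutely_continuous (distr \<tau> Fs f) (distr \<eta> Fs f)) \<and>
         (mutually_singular \<eta> \<tau> \<longleftrightarrow>
            mutually_singular (distr \<eta> Fs f) (distr \<tau> Fs f))"
proof -
  let ?g = "the_inv_into (space F) f"
  have "?g (f x) = x" if "x \<in> space F" for x
    using assms(6) that by (auto simp: bij_betw_def the_inv_into_f_f)
  then have distr_back: "distr (distr M Fs f) F ?g = M" if "sets M = sets F" for M :: "'a measure"
    using distr_distr_left_inverse[OF assms(5,7)] that by blast
  have f: "f \<in> measurable M Fs" if "sets M = sets F" for M :: "'a measure"
    using assms(5) measurable_cong_sets[OF that refl] by blast
  have g: "?g \<in> measurable (distr M Fs f) F" for M :: "'a measure"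
    using assms(7) by simp
  have sets_eq: "sets \<eta> = sets \<tau>"
    using assms(2,4) by simp
  show ?thesis
    \<comment> \<open>Each lemma is used twice: along \<open>f\<close>, and along \<open>?g\<close>
      on the image measures, where \<open>distr_back\<close> turns the twice-pushed measures into
      \<open>\<eta>\<close> and \<open>\<tau>\<close> and yields the opposite implication.\<close>
    using absolutely_continuous_distr[OF f[OF assms(4)] sets_eq]
      absolutely_continuous_distr[OF g, of "distr \<eta> Fs f" \<tau>]
      mutually_singular_if_distr[OF f[OF assms(2)] sets_eq[symmetric]]
      mutually_singular_if_distr[OF g, of "distr \<tau> Fs f" \<eta>]
      distr_back[OF assms(2)] distr_back[OF assms(4)]
    by auto
qed

end
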